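(* Let $\mathcal{G}$ and $\mathcal{G}'$ be any pair of dags (over the same finite node set) such that $\mathcal{G}\approx\mathcal{G}'$. For every integer $k$, if $\mathcal{G}$ has a node with exactly $k$ parents, then $\mathcal{G}'$ has a node with exactly $k$ parents.
   Context: All graphs have the same finite vertex set $U=\{x_1,\dots,x_n\}$; a dag is an acyclic directed graph on $U$. Each node $x_i$ is a discrete variable with a finite number $r_i\ge 2$ of states. $\Pi_x^{\mathcal{G}}$ denotes the set of parents of $x$ in $\mathcal{G}$. A Bayesian network with structure $\mathcal{G}$ is a pair $(\mathcal{G},\theta_{\mathcal{G}})$ where $\theta_{\mathcal{G}}$ is a collection of conditional distributions $p(x_i\mid\Pi_{x_i}^{\mathcal{G}})$; it defines the joint distribution $\prod_i p(x_i\mid\Pi_{x_i}^{\mathcal{G}})$. Two dags are equivalent, written $\mathcal{G}\approx\mathcal{G}'$, if for every Bayesian network $(\mathcal{G},\theta_{\mathcal{G}})$ there is a Bayesian network $(\mathcal{G}',\theta_{\mathcal{G}'})$ defining the same joint distribution, and vice versa. Known fact (Verma and Pearl): $\mathcal{G}\approx\mathcal{G}'$ if and only if they have the same skeleton (underlying undirected graph) and the same v-structures (ordered triples $(x,y,z)$ of distinct nodes with $x\to y$, $z\to y$ and $x,z$ not adjacent). *)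

theory Defs
  imports "HOL-Probability.Probability_Mass_Function" "HOL-Library.FuncSet"
begin

text \<open>
  A graph on the node set \<open>U\<close> is its set of directed edges; \<open>(y, x) \<in> G\<close> is the edge
  \<open>y \<rightarrow> x\<close>. Acyclicity excludes loops.
\<close>

definition dag :: "'a set \<Rightarrow> ('a \<times> 'a) set \<Rightarrow> bool" where
  "dag U G \<longleftrightarrow> finite U \<and> G \<subseteq> U \<times> U \<and> acyclic G"

definition parents :: "('a \<times> 'a) set \<Rightarrow> 'a \<Rightarrow> 'a set" where
  "parents G x = {y. (y, x) \<in> G}"

text \<open>The states of a node \<open>x\<close> are the numbers below \<open>r x\<close>.\<close>

definition configs :: "('a \<Rightarrow> nat) \<Rightarrow> 'a set \<Rightarrow> ('a \<Rightarrow> nat) set" where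
  "configs r S = (\<Pi>\<^sub>E x\<in>S. {..<r x})"

text \<open>
  \<open>\<theta> x \<pi>\<close> is the conditional distribution of \<open>x\<close> given that its parents are in
  configuration \<open>\<pi>\<close>. Zero probabilities are allowed.
\<close>

type_synonym 'a cpds = "'a \<Rightarrow> ('a \<Rightarrow> nat) \<Rightarrow> nat pmf"

definition bayesian_network ::
    "'a set \<Rightarrow> ('a \<Rightarrow> nat) \<Rightarrow> ('a \<times> 'a) set \<Rightarrow> 'a cpds \<Rightarrow> bool" where
  "bayesian_network U r G \<theta> \<longleftrightarrow>
     dag U G \<and> (\<forall>x\<in>U. \<forall>\<pi>\<in>configs r (parents G x). set_pmf (\<theta> x \<pi>) \<subseteq> {..<r x})"

definition joint :: "'a set \<Rightarrow> ('a \<times> 'a) set \<Rightarrow> 'a cpds \<Rightarrow> ('a \<Rightarrow> nat) \<Rightarrow> real" where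
  "joint U G \<theta> c = (\<Prod>x\<in>U. pmf (\<theta> x (restrict c (parents G x))) (c x))"

definition same_joint ::
    "'a set \<Rightarrow> ('a \<Rightarrow> nat) \<Rightarrow> ('a \<times> 'a) set \<Rightarrow> 'a cpds \<Rightarrow> ('a \<times> 'a) set \<Rightarrow> 'a cpds \<Rightarrow> bool" where
  "same_joint U r G \<theta> G' \<theta>' \<longleftrightarrow> (\<forall>c\<in>configs r U. joint U G \<theta> c = joint U G' \<theta>' c)"

definition dag_equivalent ::
    "'a set \<Rightarrow> ('a \<Rightarrow> nat) \<Rightarrow> ('a \<times> 'a) set \<Rightarrow> ('a \<times> 'a) set \<Rightarrow> bool" where
  "dag_equivalent U r G G' \<longleftrightarrow>
     (\<forall>\<theta>. bayesian_network U r G \<theta> \<longrightarrow>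
        (\<exists>\<theta>'. bayesian_network U r G' \<theta>' \<and> same_joint U r G \<theta> G' \<theta>')) \<and>
     (\<forall>\<theta>'. bayesian_network U r G' \<theta>' \<longrightarrow>
        (\<exists>\<theta>. bayesian_network U r G \<theta> \<and> same_joint U r G \<theta> G' \<theta>'))"

end

theory Submission
  imports Defs "HOL-Computational_Algebra.Polynomial"
begin

text \<open>
  Call a set \<open>S\<close> of nodes a family set of \<open>G\<close> if some \<open>x \<in> S\<close> has all of \<open>S - {x}\<close> among its
  parents. By acyclicity \<open>x\<close> is unique, so \<open>G\<close> has exactly \<open>\<Sum>x. card (parents G x) choose m\<close>
  family sets of size \<open>m + 1\<close>, and these binomial moments determine how many nodes have \<open>k\<close>
  parents. It remains to see that equivalent dags have the same family sets. If \<open>S\<close> is one of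
  \<open>G\<close>, then \<open>G\<close> represents a distribution whose support consists of the configurations that
  have even parity on \<open>S\<close> and vanish outside \<open>S\<close>. In \<open>G'\<close>, let \<open>y \<in> S\<close> have no descendant
  in \<open>S\<close>. If some \<open>z \<in> S - {y}\<close> were not a parent of \<open>y\<close>, then \<open>y\<close> could not react to a flip
  of \<open>z\<close>, and a configuration of odd parity would have positive probability.
\<close>

definition family_set :: "('a \<times> 'a) set \<Rightarrow> 'a set \<Rightarrow> bool" where
  "family_set G S \<longleftrightarrow> (\<exists>x\<in>S. S - {x} \<subseteq> parents G x)"

text \<open>The conclusion excludes paths, not only edges: a path from \<open>y\<close> back into
  \<open>S\<close> may run through nodes outside \<open>S\<close>. Hence the relation shown to be
  well-founded is the converse of the transitive closure, restricted to \<open>S\<close>.\<close>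

lemma acyclic_maximal_element:
  assumes "acyclic G" "finite S" "S \<noteq> {}"
  obtains y where "y \<in> S" "\<And>w. w \<in> S \<Longrightarrow> (y, w) \<notin> G\<^sup>+"
proof -
  have "wf (((G\<^sup>+)\<inverse>) \<inter> S \<times> S)"
  proof (rule finite_acyclic_wf)
    show "finite ((G\<^sup>+)\<inverse> \<inter> S \<times> S)"
      using assms(2) by blast
    have "acyclic ((G\<^sup>+)\<inverse>)"
      using assms(1) by (simp add: acyclic_def trancl_converse)
    then show "acyclic ((G\<^sup>+)\<inverse> \<inter> S \<times> S)"
      by (rule acyclic_subset) blast
  qed
  moreover obtain s where "s \<in> S"
    using assms(3) by blast
  ultimately obtain y where "y \<in> S" "\<And>w. (w, y) \<in> (G\<^sup>+)\<inverse> \<inter> S \<times> S \<Longrightarrow> w \<notin> S"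
    using wfE_min by metis
  then show thesis
    using that by blast
qed

lemma acyclic_minimal_element:
  assumes "acyclic G" "finite S" "S \<noteq> {}"
  obtains y where "y \<in> S" "parents G y \<inter> S = {}"
proof -
  have "acyclic (G\<inverse>)"
    using assms(1) by simp
  then obtain y where "y \<in> S" "\<And>w. w \<in> S \<Longrightarrow> (y, w) \<notin> (G\<inverse>)\<^sup>+"
    using assms(2,3) acyclic_maximal_element by metis
  then show thesis
    using that[of y] by (auto simp: parents_def)
qed

lemma parents_subset: "dag U G \<Longrightarrow> parents G x \<subseteq> U"
  by (auto simp: dag_def parents_def)

subsection \<open>Supports of Bayesian networks\<close>

text \<open>Positivity of the factor that \<open>x\<close> contributes to \<open>joint\<close>. Two
  networks are compared below only through their supports, so positivity is all that
  matters.\<close>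

definition supported ::
    "('a \<times> 'a) set \<Rightarrow> 'a cpds \<Rightarrow> ('a \<Rightarrow> nat) \<Rightarrow> 'a \<Rightarrow> bool" where
  "supported G \<theta> c x \<longleftrightarrow> c x \<in> set_pmf (\<theta> x (restrict c (parents G x)))"

lemma joint_nonzero_iff:
  "finite U \<Longrightarrow> joint U G \<theta> c \<noteq> 0 \<longleftrightarrow> (\<forall>x\<in>U. supported G \<theta> c x)"
  by (auto simp: joint_def supported_def set_pmf_eq)

lemma supported_cong:
  assumes "c x = c' x" "\<And>v. v \<in> parents G x \<Longrightarrow> c v = c' v"
  shows "supported G \<theta> c x \<longleftrightarrow> supported G \<theta> c' x"
proof -
  have "restrict c (parents G x) = restrict c' (parents G x)"
    using assms(2) by (simp add: restrict_def fun_eq_iff)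
  then show ?thesis
    using assms(1) by (simp add: supported_def)
qed

text \<open>Ancestral sampling: the nodes outside the ancestral set \<open>B\<close> receive values
  one at a time, parents first. Each conditional distribution has nonempty support, so a value of
  positive probability always exists.\<close>

lemma supported_extension:
  assumes "bayesian_network U r G \<theta>"
    and "B \<subseteq> U" and "\<And>w. w \<in> B \<Longrightarrow> parents G w \<subseteq> B"
    and "\<And>w. w \<in> B \<Longrightarrow> supported G \<theta> c w" and "\<And>w. w \<in> B \<Longrightarrow> c w < r w"
  shows "\<exists>c'\<in>configs r U. (\<forall>w\<in>B. c' w = c w) \<and> (\<forall>w\<in>U. supported G \<theta> c' w)"
  using assms(2-)
proof (induction "card (U - B)" arbitrary: B c rule: less_induct)
  case less
  have dag: "dag U G"
    using assms(1) by (simp add: bayesian_network_def)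
  then have fin: "finite U" and ac: "acyclic G"
    by (auto simp: dag_def)
  show ?case
  proof (cases "B = U")
    case True
    \<comment> \<open>Members of \<open>configs r U\<close> are extensional, whereas
      \<open>c\<close> is arbitrary outside \<open>U\<close>.\<close>
    have "supported G \<theta> (restrict c U) w" if "w \<in> U" for w
      using supported_cong[of "restrict c U" w c G \<theta>] less.prems(3) that True
        parents_subset[OF dag] by (auto simp: subset_iff)
    moreover have "restrict c U \<in> configs r U"
      using less.prems(4) True
      by (auto simp: configs_def)
    ultimately show ?thesis
      using True by (intro bexI[of _ "restrict c U"]) auto
  next
    case False
    then have "U - B \<noteq> {}" "finite (U - B)"
      using less.prems(1) fin by auto
    then obtain w where w: "w \<in> U - B" "parents G w \<inter> (U - B) = {}"
      using ac acyclic_minimal_element by metis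
    then have pw: "parents G w \<subseteq> B"
      using parents_subset[OF dag] by blast
    \<comment> \<open>A Bayesian network bounds the support of \<open>\<theta> w\<close> only at
      legitimate parent configurations; this one is legitimate because all parents of
      \<open>w\<close> already lie in \<open>B\<close>.\<close>
    have "restrict c (parents G w) \<in> configs r (parents G w)"
      using pw less.prems(4) by (auto simp: configs_def)
    then have sub: "set_pmf (\<theta> w (restrict c (parents G w))) \<subseteq> {..<r w}"
      using assms(1) w(1) by (auto simp: bayesian_network_def)
    obtain s where s: "s \<in> set_pmf (\<theta> w (restrict c (parents G w)))"
      using set_pmf_not_empty by fast
    define d where "d = c(w := s)"
    have dc: "d v = c v" if "v \<in> B" for v
      using that w(1) by (auto simp: d_def)
    have "\<exists>c'\<in>configs r U. (\<forall>v\<in>insert w B. c' v = d v) \<and> (\<forall>v\<in>U. supported G \<theta> c' v)"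
    proof (rule less.hyps)
      show "card (U - insert w B) < card (U - B)"
        using w(1) fin by (intro psubset_card_mono) auto
      show "insert w B \<subseteq> U"
        using w(1) less.prems(1) by auto
    next
      fix v assume v: "v \<in> insert w B"
      then show "parents G v \<subseteq> insert w B"
        using pw less.prems(2) by blast
      have "restrict d (parents G w) = restrict c (parents G w)"
        using pw dc by (auto simp: restrict_def fun_eq_iff)
      then have "supported G \<theta> d w"
        using s by (simp add: supported_def d_def)
      moreover have "supported G \<theta> d v" if "v \<in> B"
        using supported_cong[of d v c G \<theta>] that dc less.prems(2,3) by blast
      ultimately show "supported G \<theta> d v"
        using v by blast
      show "d v < r v"
        using v s sub less.prems(4) by (auto simp: d_def)
    qed
    then show ?thesis
      using dc by (metis insertCI)
  qed
qed

section \<open>Parity distributions and the transfer of family sets\<close>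

lemma parity_network:
  assumes r: "\<And>x. x \<in> U \<Longrightarrow> 2 \<le> r x" and dag: "dag U G"
    and S: "S \<subseteq> U" and fam: "family_set G S"
  obtains \<theta> where "bayesian_network U r G \<theta>"
    and "\<And>c. joint U G \<theta> c \<noteq> 0 \<longleftrightarrow>
           (\<forall>w\<in>S. c w < 2) \<and> (\<forall>w\<in>U - S. c w = 0) \<and> even (\<Sum>w\<in>S. c w)"
proof -
  obtain x where x: "x \<in> S" "S - {x} \<subseteq> parents G x"
    using fam by (auto simp: family_set_def)
  have fin: "finite U" "finite S"
    using dag S finite_subset by (auto simp: dag_def)
  \<comment> \<open>The nodes of \<open>S - {x}\<close> are independent fair bits, and
    \<open>x\<close> is their parity bit, which it can compute because they are all its parents.
    Every other node is constantly 0.\<close>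
  define \<theta> :: "'a cpds" where
    "\<theta> = (\<lambda>w \<pi>. if w = x then return_pmf ((\<Sum>v\<in>S - {x}. \<pi> v) mod 2)
                else if w \<in> S then pmf_of_set {0, 1} else return_pmf 0)"
  have bn: "bayesian_network U r G \<theta>"
    unfolding bayesian_network_def
  proof (intro conjI ballI dag)
    fix w \<pi> assume "w \<in> U"
    then show "set_pmf (\<theta> w \<pi>) \<subseteq> {..<r w}"
      using r[of w] by (auto simp: \<theta>_def)
  qed
  have joint: "joint U G \<theta> c \<noteq> 0 \<longleftrightarrow>
           (\<forall>w\<in>S. c w < 2) \<and> (\<forall>w\<in>U - S. c w = 0) \<and> even (\<Sum>w\<in>S. c w)" for c
  proof -
    have "supported G \<theta> c w \<longleftrightarrow> c w < 2" if "w \<in> S - {x}" for w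
      using that by (auto simp: supported_def \<theta>_def less_2_cases_iff)
    moreover have "supported G \<theta> c w \<longleftrightarrow> c w = 0" if "w \<in> U - S" for w
      using that x(1) by (auto simp: supported_def \<theta>_def)
    moreover have "supported G \<theta> c x \<longleftrightarrow> c x < 2 \<and> even (\<Sum>w\<in>S. c w)"
    proof -
      have "(\<Sum>v\<in>S - {x}. restrict c (parents G x) v) = (\<Sum>v\<in>S - {x}. c v)"
        using x(2) by (intro sum.cong) auto
      moreover have "(\<Sum>w\<in>S. c w) = c x + (\<Sum>v\<in>S - {x}. c v)"
        using fin x(1) by (simp add: sum.remove)
      moreover have "a = n mod 2 \<longleftrightarrow> a < 2 \<and> even (a + n)" for a n :: nat
        by presburger
      ultimately show ?thesis
        by (simp add: supported_def \<theta>_def)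
    qed
    moreover have "(\<forall>w\<in>U. Q w) \<longleftrightarrow> Q x \<and> (\<forall>w\<in>S - {x}. Q w) \<and> (\<forall>w\<in>U - S. Q w)" for Q
      using x(1) S by blast
    moreover have "(\<forall>w\<in>S. c w < 2) \<longleftrightarrow> c x < 2 \<and> (\<forall>w\<in>S - {x}. c w < 2)"
      using x(1) by blast
    ultimately show ?thesis
      unfolding joint_nonzero_iff[OF fin(1)] by auto
  qed
  show thesis
    using bn joint by (rule that)
qed

lemma family_set_transfer:
  assumes r: "\<And>x. x \<in> U \<Longrightarrow> 2 \<le> r x"
    and dag: "dag U G" and dag': "dag U G'"
    and eq: "dag_equivalent U r G G'"
    and S: "S \<subseteq> U" and fam: "family_set G S"
  shows "family_set G' S"
proof -
  obtain \<theta> where bn: "bayesian_network U r G \<theta>"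
    and joint: "\<And>c. joint U G \<theta> c \<noteq> 0 \<longleftrightarrow>
           (\<forall>w\<in>S. c w < 2) \<and> (\<forall>w\<in>U - S. c w = 0) \<and> even (\<Sum>w\<in>S. c w)"
    using parity_network[where r = r, OF _ dag S fam] r by blast
  obtain \<theta>' where bn': "bayesian_network U r G' \<theta>'" and same: "same_joint U r G \<theta> G' \<theta>'"
    using eq bn by (auto simp: dag_equivalent_def)
  have fin: "finite U" "finite S"
    using dag S finite_subset by (auto simp: dag_def)
  have sup: "(\<forall>x\<in>U. supported G' \<theta>' c x) \<longleftrightarrow>
      (\<forall>w\<in>S. c w < 2) \<and> (\<forall>w\<in>U - S. c w = 0) \<and> even (\<Sum>w\<in>S. c w)"
    if "c \<in> configs r U" for c
    using that same joint[of c] joint_nonzero_iff[OF fin(1), of G' \<theta>' c]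
    by (simp add: same_joint_def)
  have "acyclic G'" "S \<noteq> {}"
    using dag' fam by (auto simp: dag_def family_set_def)
  then obtain y where y: "y \<in> S" "\<And>w. w \<in> S \<Longrightarrow> (y, w) \<notin> G'\<^sup>+"
    using fin(2) acyclic_maximal_element by metis
  have "z \<in> parents G' y" if z: "z \<in> S" "z \<noteq> y" for z
  proof (rule ccontr)
    assume nz: "z \<notin> parents G' y"
    \<comment> \<open>The contradiction comes from combining the even configurations
      \<open>conf {}\<close> and \<open>conf {y, z}\<close> locally into the odd configuration
      \<open>conf {z}\<close>.\<close>
    define conf :: "'a set \<Rightarrow> 'a \<Rightarrow> nat" where "conf T = restrict (indicator T) U" for T
    have conf: "conf T \<in> configs r U" for T
      using r by (force simp: conf_def configs_def indicator_def)
    have sum_conf: "(\<Sum>w\<in>S. conf T w) = card T" if "T \<subseteq> S" for T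
    proof -
      have "(\<Sum>w\<in>S. conf T w) = (\<Sum>w\<in>S. indicator T w)"
        using S by (intro sum.cong) (auto simp: conf_def)
      also have "\<dots> = card T"
        using fin that by (simp add: sum_indicator_eq_card Int_absorb1)
      finally show ?thesis .
    qed
    have even_sup: "\<forall>x\<in>U. supported G' \<theta>' (conf T) x" if "T \<subseteq> S" "even (card T)" for T
      unfolding sup[OF conf] using that S sum_conf[OF that(1)]
      by (auto simp: conf_def indicator_def)
    \<comment> \<open>The non-descendants of \<open>y\<close>, including \<open>y\<close> itself.
      They are closed under parents, since a child of a descendant is a descendant.\<close>
    define B where "B = {w \<in> U. (y, w) \<notin> G'\<^sup>+}"
    have "S \<subseteq> B"
      using y(2) S by (auto simp: B_def)
    \<comment> \<open>Descendants of \<open>y\<close> may assign probability 0 to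
      \<open>conf {z}\<close>, so their values are chosen anew. They lie outside \<open>S\<close>,
      hence the parity on \<open>S\<close> stays odd.\<close>
    have "\<exists>c\<in>configs r U. (\<forall>w\<in>B. c w = conf {z} w) \<and> (\<forall>w\<in>U. supported G' \<theta>' c w)"
    proof (rule supported_extension[OF bn'])
      show "B \<subseteq> U"
        by (auto simp: B_def)
    next
      fix w assume w: "w \<in> B"
      then show "parents G' w \<subseteq> B"
        using parents_subset[OF dag'] by (auto simp: B_def parents_def intro: trancl_into_trancl)
      show "conf {z} w < r w"
        using w conf[of "{z}"] by (auto simp: configs_def B_def PiE_iff)
      have wU: "w \<in> U" and yw: "y \<notin> parents G' w"
        using w by (auto simp: B_def parents_def)
      show "supported G' \<theta>' (conf {z}) w"
      \<comment> \<open>At \<open>y\<close>, \<open>conf {z}\<close> looks like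
        \<open>conf {}\<close>, as \<open>z\<close> is neither \<open>y\<close> nor a parent of it.
        At any other node of \<open>B\<close> it looks like \<open>conf {y, z}\<close>, as
        \<open>y\<close> is not a parent there.\<close>
      proof (cases "w = y")
        case True
        have "supported G' \<theta>' (conf {}) w"
          using even_sup[of "{}"] wU by simp
        moreover have "conf {z} v = conf {} v" if "v \<noteq> z" for v
          using that by (simp add: conf_def restrict_def)
        ultimately show ?thesis
          using supported_cong[of "conf {z}" w "conf {}" G' \<theta>'] True z(2) nz by metis
      next
        case False
        have "supported G' \<theta>' (conf {y, z}) w"
          using even_sup[of "{y, z}"] wU y(1) z by simp
        moreover have "conf {z} v = conf {y, z} v" if "v \<noteq> y" for v
          using that by (simp add: conf_def restrict_def indicator_def)
        ultimately show ?thesis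
          using supported_cong[of "conf {z}" w "conf {y, z}" G' \<theta>'] False yw by metis
      qed
    qed
    then obtain c where c: "c \<in> configs r U" "\<forall>w\<in>B. c w = conf {z} w"
      "\<forall>w\<in>U. supported G' \<theta>' c w"
      by blast
    have "(\<Sum>w\<in>S. c w) = (\<Sum>w\<in>S. conf {z} w)"
      using c(2) \<open>S \<subseteq> B\<close> by (intro sum.cong) auto
    also have "\<dots> = 1"
      using sum_conf[of "{z}"] z(1) by simp
    finally show False
      using sup[OF c(1)] c(3) by simp
  qed
  then show ?thesis
    using y(1) by (auto simp: family_set_def)
qed

lemma dag_equivalent_sym: "dag_equivalent U r G G' \<Longrightarrow> dag_equivalent U r G' G"
  by (auto simp: dag_equivalent_def same_joint_def eq_commute)

subsection \<open>Counting\<close>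

text \<open>Pairs of a node \<open>x\<close> and an \<open>m\<close>-element set \<open>T\<close> of
  its parents correspond to family sets through \<open>insert x T\<close>. Two distinct choices of
  \<open>x\<close> for one set would be parents of each other, a 2-cycle.\<close>

lemma card_family_sets:
  assumes "dag U G"
  shows "card {S. S \<subseteq> U \<and> card S = Suc m \<and> family_set G S} =
    (\<Sum>x\<in>U. card (parents G x) choose m)"
proof -
  define P where "P = (SIGMA x:U. {T. T \<subseteq> parents G x \<and> card T = m})"
  have fin: "finite U"
    using assms by (simp add: dag_def)
  have finp: "finite (parents G x)" for x
    using parents_subset[OF assms] fin by (rule finite_subset)
  have ac: "(a, a) \<notin> G\<^sup>+" for a
    using assms by (auto simp: dag_def acyclic_def)
  have irr: "x \<notin> parents G x" for x
    using ac by (auto simp: parents_def)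
  have "inj_on (\<lambda>(x, T). insert x T) P"
  proof (rule inj_onI, clarsimp simp: P_def)
    fix x T x' T'
    assume T: "T \<subseteq> parents G x" and T': "T' \<subseteq> parents G x'" and e: "insert x T = insert x' T'"
    have "x = x'"
    proof (rule ccontr)
      assume "x \<noteq> x'"
      then have "x' \<in> parents G x" "x \<in> parents G x'"
        using T T' e by auto
      then have "(x, x) \<in> G\<^sup>+"
        by (auto simp: parents_def intro: trancl_into_trancl)
      then show False
        using ac by blast
    qed
    moreover have "x \<notin> T" "x' \<notin> T'"
      using T T' irr by blast+
    ultimately show "x = x' \<and> T = T'"
      using e by auto
  qed
  moreover have "(\<lambda>(x, T). insert x T) ` P = {S. S \<subseteq> U \<and> card S = Suc m \<and> family_set G S}"
  proof (intro equalityI subsetI)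
    fix S assume "S \<in> (\<lambda>(x, T). insert x T) ` P"
    then obtain x T where S: "S = insert x T" "x \<in> U" "T \<subseteq> parents G x" "card T = m"
      by (auto simp: P_def)
    moreover have "finite T" "x \<notin> T"
      using S(3) finp irr finite_subset by blast+
    ultimately show "S \<in> {S. S \<subseteq> U \<and> card S = Suc m \<and> family_set G S}"
      using parents_subset[OF assms] by (auto simp: family_set_def)
  next
    fix S assume "S \<in> {S. S \<subseteq> U \<and> card S = Suc m \<and> family_set G S}"
    then obtain x where x: "S \<subseteq> U" "card S = Suc m" "x \<in> S" "S - {x} \<subseteq> parents G x"
      by (auto simp: family_set_def)
    then have "(x, S - {x}) \<in> P" "S = insert x (S - {x})"
      by (auto simp: P_def)
    then show "S \<in> (\<lambda>(x, T). insert x T) ` P"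
      by (metis (mono_tags, lifting) case_prod_conv image_eqI)
  qed
  ultimately have "card {S. S \<subseteq> U \<and> card S = Suc m \<and> family_set G S} = card P"
    by (metis card_image)
  also have "\<dots> = (\<Sum>x\<in>U. card (parents G x) choose m)"
    unfolding P_def using fin finp by (subst card_SigmaI) (auto simp: n_subsets)
  finally show ?thesis .
qed

text \<open>The generating polynomial, the sum of X^(d x) over \<open>A\<close>, has the fibre sizes
  as coefficients in powers of X and the binomial moments as coefficients in powers of X - 1. Equal
  moments thus give equal polynomials and equal fibre sizes.\<close>

lemma card_fibre_eq_if_binomial_moments_eq:
  fixes d d' :: "'a \<Rightarrow> nat"
  assumes fin: "finite A"
    and mom: "\<And>m. (\<Sum>x\<in>A. d x choose m) = (\<Sum>x\<in>A. d' x choose m)"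
  shows "card {x \<in> A. d x = k} = card {x \<in> A. d' x = k}"
proof -
  \<comment> \<open>\<open>Y\<close> is X - 1, so that X^n = (Y + 1)^n expands binomially.\<close>
  define Y :: "int poly" where "Y = [:-1, 1:]"
  \<comment> \<open>A common bound gives all expansions the same index range, so the sums over
    \<open>x\<close> and \<open>m\<close> can be swapped; the added binomials with
    \<open>m > n\<close> are 0.\<close>
  obtain N where N: "\<And>x. x \<in> A \<Longrightarrow> d x \<le> N \<and> d' x \<le> N"
  proof
    show "d x \<le> (\<Sum>x\<in>A. d x + d' x) \<and> d' x \<le> (\<Sum>x\<in>A. d x + d' x)" if "x \<in> A" for x
      using member_le_sum[OF that, of "\<lambda>x. d x + d' x"] fin by auto
  qed
  have X: "monom 1 n = (\<Sum>m\<le>N. of_nat (n choose m) * Y ^ m)" if "n \<le> N" for n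
  proof -
    have "monom 1 n = (Y + 1) ^ n"
      by (simp add: Y_def monom_altdef one_pCons)
    also have "\<dots> = (\<Sum>m\<le>n. of_nat (n choose m) * Y ^ m)"
      by (simp add: binomial_ring)
    also have "\<dots> = (\<Sum>m\<le>N. of_nat (n choose m) * Y ^ m)"
      using that by (intro sum.mono_neutral_left) (auto simp: binomial_eq_0)
    finally show ?thesis .
  qed
  have gen: "(\<Sum>x\<in>A. monom 1 (e x)) = (\<Sum>m\<le>N. of_nat (\<Sum>x\<in>A. e x choose m) * Y ^ m)"
    if "\<And>x. x \<in> A \<Longrightarrow> e x \<le> N" for e
  proof -
    have "(\<Sum>x\<in>A. monom 1 (e x)) = (\<Sum>x\<in>A. \<Sum>m\<le>N. of_nat (e x choose m) * Y ^ m)"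
      using X that by (intro sum.cong) auto
    also have "\<dots> = (\<Sum>m\<le>N. \<Sum>x\<in>A. of_nat (e x choose m) * Y ^ m)"
      by (rule sum.swap)
    finally show ?thesis
      by (simp add: sum_distrib_right)
  qed
  have coeff: "coeff (\<Sum>x\<in>A. monom (1::int) (e x)) k = int (card {x \<in> A. e x = k})" for e
    using fin by (simp add: coeff_sum sum.If_cases Int_def)
  have "(\<Sum>x\<in>A. monom (1::int) (d x)) = (\<Sum>x\<in>A. monom 1 (d' x))"
    using gen[of d] gen[of d'] N mom by simp
  then show ?thesis
    using coeff[of d] coeff[of d'] by simp
qed

theorem theorem9:
  fixes U :: "'a set" and r :: "'a \<Rightarrow> nat" and G G' :: "('a \<times> 'a) set" and k :: int
  assumes "finite U"
    and "\<And>x. x \<in> U \<Longrightarrow> 2 \<le> r x"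
    and "dag U G" and "dag U G'"
    and "dag_equivalent U r G G'"
    and "\<exists>x\<in>U. int (card (parents G x)) = k"
  shows "\<exists>x\<in>U. int (card (parents G' x)) = k"
proof -
  have "family_set G S \<longleftrightarrow> family_set G' S" if "S \<subseteq> U" for S
    using family_set_transfer[where r = r, OF assms(2) assms(3,4) _ that]
      family_set_transfer[where r = r, OF assms(2) assms(4,3) _ that]
      assms(5) dag_equivalent_sym[OF assms(5)] by blast
  then have "{S. S \<subseteq> U \<and> card S = Suc m \<and> family_set G S} =
      {S. S \<subseteq> U \<and> card S = Suc m \<and> family_set G' S}" for m
    by blast
  then have "(\<Sum>x\<in>U. card (parents G x) choose m) = (\<Sum>x\<in>U. card (parents G' x) choose m)" for m
    by (simp only: card_family_sets[OF assms(3), symmetric] card_family_sets[OF assms(4), symmetric])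
  then have fibres:
    "card {x \<in> U. card (parents G x) = j} = card {x \<in> U. card (parents G' x) = j}" for j
    by (rule card_fibre_eq_if_binomial_moments_eq[OF assms(1)])
  obtain x where x: "x \<in> U" "int (card (parents G x)) = k"
    using assms(6) by blast
  \<comment> \<open>\<open>k\<close> is the cardinality of a parent set, hence nonnegative, and
    passing to \<open>nat k\<close> loses nothing.\<close>
  then have "card {x \<in> U. card (parents G x) = nat k} > 0"
    using assms(1) by (auto simp: card_gt_0_iff)
  then have "card {x \<in> U. card (parents G' x) = nat k} > 0"
    unfolding fibres .
  then have "{x \<in> U. card (parents G' x) = nat k} \<noteq> {}"
    unfolding card_gt_0_iff by (rule conjunct1)
  then show ?thesis
    using x(2) by auto
qed

end
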